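(* There is a universal constant $C>0$ such that for every frequency $\lambda=(\lambda_n)$, all $0<k\le 1$, all $N\in\mathbf{N}$ and all $D=\sum a_n e^{-\lambda_n s}\in\mathcal{D}_\infty^{ext}(\lambda)$, $$\sup_{[Re>0]}\left|\sum_{n=1}^{N} a_n e^{-\lambda_n s}\right|\le C\,\frac{\Gamma(k+1)}{k}\left(\frac{\lambda_{N+1}}{\lambda_{N+1}-\lambda_N}\right)^{k}\|D\|_\infty,$$ where $\Gamma$ denotes the Gamma function.
   Context: A frequency is a strictly increasing sequence $\lambda=(\lambda_n)_{n\in\mathbf{N}}$ of non-negative real numbers tending to $+\infty$ (so $\mathbf{N}=\{1,2,\dots\}$ and $\lambda_1=0$ is allowed). A $\lambda$-Dirichlet series is a formal sum $D=\sum_{n\ge 1} a_n e^{-\lambda_n s}$ with complex coefficients $a_n$ and complex variable $s$. For $\sigma\in\mathbf{R}$, $[Re>\sigma]=\{s\in\mathbf{C}: \mathrm{Re}\,s>\sigma\}$. If $D$ converges at some point, it converges on some half-plane $[Re>\sigma]$ to a holomorphic function. $\mathcal{D}_\infty^{ext}(\lambda)$ is the space of all $\lambda$-Dirichlet series $D$ which converge at some point of $\mathbf{C}$ and whose limit function has a (unique) holomorphic and bounded extension $f$ to $[Re>0]$; one sets $\|D\|_\infty:=\sup_{[Re>0]}|f(s)|$. *)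

theory Defs
  imports "HOL-Complex_Analysis.Complex_Analysis"
begin

text \<open>
  Sequences are indexed by \<open>{1, 2, \<dots>}\<close>: the values \<open>l 0\<close> and \<open>a 0\<close> are never used.
\<close>

definition frequency :: "(nat \<Rightarrow> real) \<Rightarrow> bool" where
  "frequency l \<longleftrightarrow>
     strict_mono_on {1..} l \<and> (\<forall>n\<ge>1. 0 \<le> l n) \<and> filterlim l at_top sequentially"

definition right_halfplane :: "real \<Rightarrow> complex set" where
  "right_halfplane \<sigma> = {s. Re s > \<sigma>}"

text \<open>A formal \<open>l\<close>-Dirichlet series is represented by its coefficient sequence \<open>a\<close>.\<close>

definition dirichlet_partial_sum ::
    "(nat \<Rightarrow> real) \<Rightarrow> (nat \<Rightarrow> complex) \<Rightarrow> nat \<Rightarrow> complex \<Rightarrow> complex" where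
  "dirichlet_partial_sum l a N s = (\<Sum>n=1..N. a n * exp (- complex_of_real (l n) * s))"

definition dirichlet_converges_to ::
    "(nat \<Rightarrow> real) \<Rightarrow> (nat \<Rightarrow> complex) \<Rightarrow> complex \<Rightarrow> complex \<Rightarrow> bool" where
  "dirichlet_converges_to l a s w \<longleftrightarrow> (\<lambda>N. dirichlet_partial_sum l a N s) \<longlonglongrightarrow> w"

text \<open>
  The series may already converge to the left of the imaginary axis, in which case the extension
  is simply the restriction of the limit function; hence \<open>\<sigma> \<ge> 0\<close>. Agreement on one half-plane
  determines \<open>f\<close> on \<open>right_halfplane 0\<close> (lemma \<open>bounded_extension_unique\<close> below).
\<close>

definition bounded_extension ::
    "(nat \<Rightarrow> real) \<Rightarrow> (nat \<Rightarrow> complex) \<Rightarrow> (complex \<Rightarrow> complex) \<Rightarrow> bool" where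
  "bounded_extension l a f \<longleftrightarrow>
     f holomorphic_on right_halfplane 0 \<and>
     bounded (f ` right_halfplane 0) \<and>
     (\<exists>\<sigma>\<ge>0. \<forall>s\<in>right_halfplane \<sigma>. dirichlet_converges_to l a s (f s))"

definition D_infty_ext :: "(nat \<Rightarrow> real) \<Rightarrow> (nat \<Rightarrow> complex) set" where
  "D_infty_ext l =
     {a. (\<exists>s w. dirichlet_converges_to l a s w) \<and> (\<exists>f. bounded_extension l a f)}"

text \<open>
  The values of an extension outside \<open>right_halfplane 0\<close> are arbitrary, so a total function
  cannot be picked by \<open>THE\<close>; by lemma \<open>D_infty_norm_eq\<close> the choice made by \<open>SOME\<close> is irrelevant.
\<close>

definition D_infty_norm :: "(nat \<Rightarrow> real) \<Rightarrow> (nat \<Rightarrow> complex) \<Rightarrow> real" where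
  "D_infty_norm l a = (SUP s\<in>right_halfplane 0. norm ((SOME f. bounded_extension l a f) s))"

lemma bounded_extension_unique:
  assumes "bounded_extension l a f" "bounded_extension l a g" "s \<in> right_halfplane 0"
  shows "f s = g s"
proof -
  obtain \<sigma> where \<sigma>: "\<sigma> \<ge> 0"
      "\<And>z. z \<in> right_halfplane \<sigma> \<Longrightarrow> dirichlet_converges_to l a z (f z)"
    using assms(1) by (auto simp: bounded_extension_def)
  obtain \<tau> where \<tau>: "\<tau> \<ge> 0"
      "\<And>z. z \<in> right_halfplane \<tau> \<Longrightarrow> dirichlet_converges_to l a z (g z)"
    using assms(2) by (auto simp: bounded_extension_def)
  define m where "m = max \<sigma> \<tau>"
  have eq: "f z = g z" if "z \<in> right_halfplane m" for z
    using \<sigma>(2)[of z] \<tau>(2)[of z] that LIMSEQ_unique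
    by (auto simp: right_halfplane_def m_def dirichlet_converges_to_def)
  have opn: "open (right_halfplane x)" for x
    by (simp add: right_halfplane_def open_halfspace_Re_gt)
  have conn: "connected (right_halfplane 0)"
    by (simp add: right_halfplane_def convex_connected convex_halfspace_Re_gt)
  have ne: "of_real (m + 1) \<in> right_halfplane m"
    by (simp add: right_halfplane_def)
  have sub: "right_halfplane m \<subseteq> right_halfplane 0"
    using \<sigma>(1) by (auto simp: right_halfplane_def m_def)
  show ?thesis
    by (rule analytic_continuation_open[of "right_halfplane m" "right_halfplane 0" f g])
       (use assms opn conn ne sub eq in \<open>auto simp: bounded_extension_def\<close>)
qed

lemma D_infty_norm_eq:
  assumes "bounded_extension l a f"
  shows "D_infty_norm l a = (SUP s\<in>right_halfplane 0. norm (f s))"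
proof -
  have "bounded_extension l a (SOME g. bounded_extension l a g)"
    using assms by (metis someI)
  from bounded_extension_unique[OF this assms] show ?thesis
    unfolding D_infty_norm_def by (intro SUP_cong) auto
qed

text \<open>The suprema involved are suprema of nonempty sets of reals that are bounded above.\<close>

lemma bdd_above_bounded_extension:
  assumes "bounded_extension l a f"
  shows "bdd_above ((\<lambda>s. norm (f s)) ` right_halfplane 0)"
  using assms unfolding bounded_extension_def bounded_iff bdd_above_def by auto

lemma bdd_above_dirichlet_partial_sum:
  assumes "frequency l"
  shows "bdd_above ((\<lambda>s. norm (dirichlet_partial_sum l a N s)) ` right_halfplane 0)"
proof (rule bdd_aboveI2)
  fix s assume s: "s \<in> right_halfplane 0"
  have "norm (a n * exp (- complex_of_real (l n) * s)) \<le> norm (a n)" if "n \<in> {1..N}" for n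
  proof -
    have "0 \<le> l n * Re s"
      using assms s that by (auto simp: frequency_def right_halfplane_def)
    then show ?thesis
      by (simp add: norm_mult mult_left_le)
  qed
  then show "norm (dirichlet_partial_sum l a N s) \<le> (\<Sum>n=1..N. norm (a n))"
    unfolding dirichlet_partial_sum_def by (intro sum_norm_le) auto
qed

lemma right_halfplane_nonempty: "right_halfplane \<sigma> \<noteq> {}"
proof -
  have "of_real (\<sigma> + 1) \<in> right_halfplane \<sigma>"
    by (simp add: right_halfplane_def)
  then show ?thesis by blast
qed

end

theory Submission
  imports Defs
begin

text \<open>
  Let \<open>S\<close> be the \<open>N\<close>-th partial sum, \<open>g = f - S\<close>, \<open>l = \<lambda>\<^sub>N\<close>, \<open>m = \<lambda>\<^bsub>N+1\<^esub>\<close>, \<open>e = (m - l) / 2\<close>, and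
  \<open>E(s) = exp(ls) ((exp(es) - 1) / (es))\<^sup>2 / s\<close>, whose exponents run from \<open>l\<close> to \<open>l + 2e = m\<close>. On the line
  \<open>Re s = 1/m\<close> the integral of \<open>f E\<close> equals \<open>2\<pi>i S(0)\<close>: by Abel summation \<open>g\<close> is
  \<open>O((1 + |s|) exp(-m Re s))\<close>, so the contour for \<open>g E\<close> can be pushed to the right, where it
  vanishes, while the contour for \<open>S E\<close> can be pushed to the left across the simple pole at \<open>0\<close>.
  On the line, \<open>|E(s)|\<close> is at most a constant times \<open>min(1, 2/(e|s|))\<^sup>2 / |s| \<le> (2/(e|s|))\<^sup>k / |s|\<close>,
  and integrating this gives the factor \<open>(m/(m-l))\<^sup>k / k\<close>. Translating \<open>f\<close> gives the bound
  at every point of the half-plane; \<open>\<Gamma>(k+1)\<close> is bounded below on \<open>(0, 1]\<close>.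
\<close>

section \<open>Estimates for differences of exponentials\<close>

text \<open>The derivative of \<open>exp (- t * w)\<close> in \<open>t\<close> has norm
  \<open>norm w * exp (- t * Re w)\<close>, and the increment of its antiderivative
  \<open>\<phi>\<close> is the bound. In this form the bounds telescope under Abel
  summation.\<close>

lemma norm_exp_diff_le:
  assumes "0 < Re w" "x \<le> y"
  shows "norm (exp (- of_real x * w) - exp (- of_real y * w))
           \<le> norm w / Re w * (exp (- x * Re w) - exp (- y * Re w))"
proof (cases "x = y")
  case False
  define \<phi> where "\<phi> t = - (norm w / Re w) * exp (- t * Re w)" for t :: real
  have d1: "((\<lambda>t. exp (- complex_of_real t * w)) has_vector_derivative
              (- w * exp (- complex_of_real t * w))) (at t)" for t
    by (rule has_vector_derivative_real_field) (auto intro!: derivative_eq_intros)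
  have d2: "(\<phi> has_vector_derivative (norm w * exp (- t * Re w))) (at t)" for t
    unfolding \<phi>_def has_real_derivative_iff_has_vector_derivative[symmetric]
    using assms by (auto intro!: derivative_eq_intros)
  have "norm (exp (- complex_of_real y * w) - exp (- complex_of_real x * w)) \<le> \<phi> y - \<phi> x"
    by (rule differentiable_bound_general[OF _ _ _ d1 d2])
       (use assms False in \<open>auto simp: norm_mult \<phi>_def intro!: continuous_intros\<close>)
  then show ?thesis
    by (simp add: norm_minus_commute \<phi>_def algebra_simps)
qed auto

text \<open>Mean value inequality on the closed left half-plane, which is convex and on which the
  derivative of \<open>exp\<close> has norm at most 1.\<close>

lemma norm_one_minus_exp_le:
  assumes "0 \<le> Re w"
  shows "norm (1 - exp (- w)) \<le> norm w"
proof -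
  have "norm (exp 0 - exp (- w)) \<le> 1 * norm (0 - (- w))"
    by (rule field_differentiable_bound[where S = "{z. Re z \<le> 0}" and f' = exp])
       (use assms in \<open>auto intro!: derivative_eq_intros simp: convex_halfspace_Re_le\<close>)
  then show ?thesis by simp
qed

section \<open>The kernel and its size on either side of the line of integration\<close>

definition exp_quot :: "real \<Rightarrow> complex \<Rightarrow> complex" where
  "exp_quot e s = (if s = 0 then 1 else (exp (of_real e * s) - 1) / (of_real e * s))"

text \<open>\<open>exp_quot e\<close> is the difference quotient at 0 of
  \<open>exp (e * s) / e\<close>, whose derivative there is 1, so the value given at 0 removes the
  singularity.\<close>

lemma holomorphic_exp_quot:
  assumes "e \<noteq> 0"
  shows "exp_quot e holomorphic_on A"
proof -
  have d: "deriv (\<lambda>s. exp (of_real e * s) / of_real e) 0 = 1"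
    by (rule DERIV_imp_deriv) (use assms in \<open>auto intro!: derivative_eq_intros\<close>)
  have "(\<lambda>s. if s = 0 then deriv (\<lambda>s. exp (of_real e * s) / of_real e) 0
      else (exp (of_real e * s) / of_real e - exp (of_real e * 0) / of_real e) / (s - 0))
    holomorphic_on UNIV"
    by (rule pole_lemma_open) (auto intro!: holomorphic_intros simp: assms)
  also have "?this \<longleftrightarrow> exp_quot e holomorphic_on UNIV"
    unfolding d by (rule holomorphic_cong) (use assms in \<open>auto simp: exp_quot_def field_simps\<close>)
  finally show ?thesis
    using holomorphic_on_subset by blast
qed

text \<open>Pulling out \<open>exp w\<close> leaves \<open>1 - exp (- w)\<close>, which for
  \<open>Re w \<ge> 0\<close> is bounded both by \<open>norm w\<close> (sharp near 0) and by 2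
  (sharp far away).\<close>

lemma norm_exp_quot_le_right:
  assumes "0 < e" "0 \<le> Re s" "s \<noteq> 0"
  shows "norm (exp_quot e s) \<le> exp (e * Re s) * min 1 (2 / (e * norm s))"
proof -
  define w where "w = of_real e * s"
  have w: "0 \<le> Re w" "norm w > 0" "norm w = e * norm s" "w \<noteq> 0"
    using assms by (auto simp: w_def norm_mult)
  have "exp w - 1 = exp w * (1 - exp (- w))"
    by (simp add: algebra_simps exp_minus)
  then have eq: "norm (exp_quot e s) = exp (Re w) * (norm (1 - exp (- w)) / norm w)"
    using w assms by (simp add: exp_quot_def norm_mult norm_divide flip: w_def)
  have "norm (1 - exp (- w)) \<le> norm (1::complex) + norm (exp (- w))"
    by (rule norm_triangle_ineq4)
  also have "\<dots> \<le> 2"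
    using w by simp
  finally have "norm (1 - exp (- w)) / norm w \<le> min 1 (2 / norm w)"
    using w norm_one_minus_exp_le[of w] by (simp add: divide_simps)
  then have "norm (exp_quot e s) \<le> exp (Re w) * min 1 (2 / norm w)"
    unfolding eq by (intro mult_left_mono) auto
  then show ?thesis
    using w(3) by (simp add: w_def)
qed

lemma norm_exp_quot_le_left:
  assumes "0 < e" "Re s \<le> c" "s \<noteq> 0"
  shows "norm (exp_quot e s) \<le> (1 + exp (e * c)) / (e * norm s)"
proof -
  have "norm (exp (of_real e * s) - 1) \<le> norm (exp (of_real e * s)) + norm (1::complex)"
    by (rule norm_triangle_ineq4)
  also have "\<dots> \<le> 1 + exp (e * c)"
    using assms by simp
  finally show ?thesis
    using assms by (simp add: exp_quot_def norm_mult norm_divide divide_right_mono)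
qed

text \<open>Trades the minimum for a pure power with a free exponent: \<open>p = k\<close> is taken
  on the line of integration, \<open>p = 2\<close> on the far sides to its right.\<close>

lemma min_one_square_le_powr:
  fixes x p :: real
  assumes "0 < x" "0 \<le> p" "p \<le> 2"
  shows "(min 1 x)^2 \<le> x powr p"
proof (cases "x \<le> 1")
  case True
  have "x powr 2 \<le> x powr p"
    by (rule powr_mono') (use assms True in auto)
  then show ?thesis
    using True assms by (simp add: powr_numeral)
next
  case False
  then show ?thesis
    using assms by (simp add: ge_one_powr_ge_zero)
qed

text \<open>
  On vertical lines this is a de la Vallee-Poussin kernel. Squaring \<open>exp_quot\<close> makes it decay like
  \<open>|s|\<^bsup>-3\<^esup>\<close>, which absorbs the factor \<open>1 + |s|\<close> in the bound for \<open>f - S\<close>.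
\<close>
definition vp_kernel :: "real \<Rightarrow> real \<Rightarrow> complex \<Rightarrow> complex" where
  "vp_kernel l e s = exp (of_real l * s) * exp_quot e s ^ 2 / s"

text \<open>The exponent \<open>l + 2 * e\<close> collects \<open>exp (l * s)\<close> and one factor
  \<open>exp (e * s)\<close> from each of the two quotients.\<close>

lemma norm_vp_kernel_le_right:
  assumes "0 < e" "0 \<le> Re s" "s \<noteq> 0" "0 \<le> p" "p \<le> 2"
  shows "norm (vp_kernel l e s)
    \<le> exp ((l + 2 * e) * Re s) * (2 / (e * norm s)) powr p / norm s"
proof -
  have "norm (exp_quot e s) ^ 2 \<le> (exp (e * Re s) * min 1 (2 / (e * norm s))) ^ 2"
    by (intro power_mono norm_exp_quot_le_right assms) auto
  also have "\<dots> = exp (2 * e * Re s) * (min 1 (2 / (e * norm s))) ^ 2"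
    by (simp add: power_mult_distrib exp_double[symmetric] mult.assoc)
  also have "\<dots> \<le> exp (2 * e * Re s) * (2 / (e * norm s)) powr p"
    by (intro mult_left_mono min_one_square_le_powr) (use assms in auto)
  finally have "exp (l * Re s) * norm (exp_quot e s) ^ 2 / norm s
      \<le> exp (l * Re s) * (exp (2 * e * Re s) * (2 / (e * norm s)) powr p) / norm s"
    by (intro divide_right_mono mult_left_mono) auto
  then show ?thesis
    by (simp add: vp_kernel_def norm_mult norm_divide norm_power ring_distribs exp_add mult.assoc)
qed

section \<open>Contour shifts in terms of primitives\<close>

text \<open>The contours are triangles with a vertical side from c - ir to c + ir and apex c + r or
  c - r; \<open>\<sigma>\<close> selects the slanted side and \<open>\<delta>\<close> the apex. On
  the half of a slanted side next to the vertical one the imaginary part is at least r/2 in size, on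
  the other half the real part is at least r/2 - c.\<close>

lemma segment_far_from_vertex:
  assumes z: "z \<in> closed_segment (Complex c (\<sigma> * r)) (Complex (c + \<delta> * r) 0)"
    and "\<sigma> \<in> {1, -1}" "\<delta> \<in> {1, -1}" "0 < c" "4 * c \<le> r"
  shows "r / 4 \<le> norm z" "0 \<le> \<delta> * (Re z - c)"
proof -
  obtain t where t: "0 \<le> t" "t \<le> 1"
    "z = (1 - t) *\<^sub>R Complex c (\<sigma> * r) + t *\<^sub>R Complex (c + \<delta> * r) 0"
    using z by (auto simp: in_segment)
  have re: "Re z = c + t * (\<delta> * r)" and im: "Im z = (1 - t) * (\<sigma> * r)"
    unfolding t(3) by (simp_all add: algebra_simps)
  show "0 \<le> \<delta> * (Re z - c)"
    using assms t unfolding re by (auto simp: algebra_simps)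
  have a: "\<bar>Re z\<bar> \<ge> t * r - c"
    using assms(3,4) unfolding re by (auto simp: algebra_simps)
  have b: "\<bar>Im z\<bar> \<ge> (1 - t) * r"
    using assms(2) unfolding im by (auto simp: algebra_simps)
  show "r / 4 \<le> norm z"
  proof (cases "t \<le> 1 / 2")
    case True
    have "(1 / 2) * r \<le> (1 - t) * r"
      by (rule mult_right_mono) (use True assms in auto)
    then show ?thesis
      using b abs_Im_le_cmod[of z] assms by linarith
  next
    case False
    have "(1 / 2) * r \<le> t * r"
      by (rule mult_right_mono) (use False assms in auto)
    then show ?thesis
      using a abs_Re_le_cmod[of z] assms by linarith
  qed
qed

lemma norm_segment_length_le:
  assumes "\<sigma> \<in> {1, -1}" "\<delta> \<in> {1, -1}" "0 \<le> r"
  shows "norm (Complex c (\<sigma> * r) - Complex (c + \<delta> * r) 0) \<le> 2 * r"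
proof -
  have "norm (Complex c (\<sigma> * r) - Complex (c + \<delta> * r) 0) \<le> \<bar>- (\<delta> * r)\<bar> + \<bar>\<sigma> * r\<bar>"
    using cmod_le[of "Complex c (\<sigma> * r) - Complex (c + \<delta> * r) 0"] by simp
  then show ?thesis
    using assms by (auto simp: abs_mult)
qed

text \<open>The increment of a primitive does not depend on the path, so the vertical segment is
  replaced by the two slanted sides through c + r, each of length at most 2r.\<close>

lemma primitive_bound_right:
  assumes P: "\<And>s. 0 < Re s \<Longrightarrow> (P has_field_derivative h s) (at s)"
    and c: "0 < c" "4 * c \<le> r"
    and h: "\<And>s. c \<le> Re s \<Longrightarrow> r / 4 \<le> norm s \<Longrightarrow> norm (h s) \<le> B"
  shows "norm (P (Complex c r) - P (Complex c (- r))) \<le> B * (4 * r)"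
proof -
  have B: "0 \<le> B"
    using h[of "of_real r"] c norm_ge_zero[of "h (of_real r)"] by (simp del: norm_ge_zero)
  have *: "norm (P (Complex c (\<sigma> * r)) - P (Complex (c + r) 0)) \<le> B * (2 * r)"
    if \<sigma>: "\<sigma> \<in> {1, -1}" for \<sigma>
  proof -
    let ?S = "closed_segment (Complex c (\<sigma> * r)) (Complex (c + 1 * r) 0)"
    have S: "c \<le> Re z" "r / 4 \<le> norm z" if "z \<in> ?S" for z
      using segment_far_from_vertex[OF that \<sigma> _ c] by auto
    have "norm (P (Complex c (\<sigma> * r)) - P (Complex (c + 1 * r) 0))
        \<le> B * norm (Complex c (\<sigma> * r) - Complex (c + 1 * r) 0)"
    proof (rule field_differentiable_bound[where S = ?S and f' = h])
      show "(P has_field_derivative h z) (at z within ?S)" if "z \<in> ?S" for z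
        using P[of z] S[OF that] c by (auto intro: has_field_derivative_at_within)
    qed (use S h in auto)
    also have "\<dots> \<le> B * (2 * r)"
      by (intro mult_left_mono norm_segment_length_le) (use \<sigma> c B in auto)
    finally show ?thesis by simp
  qed
  show ?thesis
    using *[of 1] *[of "-1"]
      norm_triangle_ineq4[of "P (Complex c r) - P (Complex (c + r) 0)"
         "P (Complex c (- r)) - P (Complex (c + r) 0)"]
    by simp
qed

text \<open>\<open>Q\<close> is a primitive only to the right of the pole, so it evaluates the
  vertical side alone; the slanted sides through c - r remain contour integrals. Cauchy's formula on
  the closed triangle around 0 supplies the residue term.\<close>

lemma primitive_residue_left:
  assumes Q: "\<And>s. 0 < Re s \<Longrightarrow> (Q has_field_derivative \<phi> s / s) (at s)"
    and \<phi>: "\<phi> holomorphic_on UNIV"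
    and c: "0 < c" "4 * c \<le> r"
    and h: "\<And>s. Re s \<le> c \<Longrightarrow> r / 4 \<le> norm s \<Longrightarrow> norm (\<phi> s / s) \<le> B"
  shows "norm (Q (Complex c r) - Q (Complex c (- r)) - 2 * pi * \<i> * \<phi> 0) \<le> B * (4 * r)"
proof -
  define a b d where "a = Complex c (- r)" "b = Complex c r" "d = Complex (c - r) 0"
  have B: "0 \<le> B"
    using h[of "of_real (- r)"] c norm_ge_zero[of "\<phi> (of_real (- r)) / of_real (- r)"]
    by (simp del: norm_ge_zero)
  have seg: "Re z \<le> c \<and> r / 4 \<le> norm z" if "z \<in> closed_segment b d \<or> z \<in> closed_segment d a" for z
  proof -
    have "z \<in> closed_segment (Complex c (1 * r)) (Complex (c + (-1) * r) 0)
        \<or> z \<in> closed_segment (Complex c ((-1) * r)) (Complex (c + (-1) * r) 0)"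
      using that by (auto simp: a_b_d_def closed_segment_commute)
    then show ?thesis
      using segment_far_from_vertex[of z c 1 r "-1"] segment_far_from_vertex[of z c "-1" r "-1"] c
      by auto
  qed
  have ab: "Re z = c" if "z \<in> closed_segment a b" for z
    using that by (auto simp: in_segment a_b_d_def left_diff_distrib)
  have nz: "0 \<notin> closed_segment a b" "0 \<notin> closed_segment b d" "0 \<notin> closed_segment d a"
    using seg[of 0] ab[of 0] c by auto
  \<comment> \<open>Equal weights on \<open>a\<close> and \<open>b\<close> cancel the imaginary
    parts, and the weight \<open>c / r\<close> on \<open>d\<close> balances the real part. As 0 lies
    on no side, it is then an interior point.\<close>
  have hull: "0 \<in> convex hull {a, b, d}"
    unfolding convex_hull_3
    by (rule CollectI, rule exI[of _ "(1 - c / r) / 2"], rule exI[of _ "(1 - c / r) / 2"],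
        rule exI[of _ "c / r"])
       (use c in \<open>auto simp: a_b_d_def complex_eq_iff field_simps\<close>)
  have int: "0 \<in> interior (convex hull {a, b, d})"
    using hull nz by (simp add: interior_of_triangle)
  let ?\<gamma> = "linepath a b +++ linepath b d +++ linepath d a"
  \<comment> \<open>The order \<open>a\<close>, \<open>b\<close>, \<open>d\<close> runs
    counterclockwise, hence the sign.\<close>
  have wn: "winding_number ?\<gamma> 0 = 1"
    using winding_number_triangle[OF int] c by (simp add: a_b_d_def)
  have I: "((\<lambda>w. \<phi> w / (w - 0)) has_contour_integral
      (2 * pi * \<i> * winding_number ?\<gamma> 0 * \<phi> 0)) ?\<gamma>"
    by (rule Cauchy_integral_formula_convex_simple[where S = UNIV])
       (use \<phi> nz in \<open>auto simp: path_image_join\<close>)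
  have ci: "(\<lambda>w. \<phi> w / w) contour_integrable_on linepath x y" if "0 \<notin> closed_segment x y" for x y
    by (rule contour_integrable_continuous_linepath)
       (use that in \<open>auto intro!: continuous_intros
           continuous_on_subset[OF holomorphic_on_imp_continuous_on[OF \<phi>]]\<close>)
  have int1: "contour_integral (linepath a b) (\<lambda>w. \<phi> w / w) = Q b - Q a"
    by (rule contour_integral_unique)
       (use contour_integral_primitive[of "closed_segment a b" Q "\<lambda>w. \<phi> w / w" "linepath a b"]
          ab Q c in \<open>auto intro: has_field_derivative_at_within\<close>)
  have "2 * pi * \<i> * \<phi> 0 = contour_integral ?\<gamma> (\<lambda>w. \<phi> w / w)"
    using contour_integral_unique[OF I] wn by simp
  also have "\<dots> = Q b - Q a + contour_integral (linepath b d) (\<lambda>w. \<phi> w / w)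
      + contour_integral (linepath d a) (\<lambda>w. \<phi> w / w)"
    using ci nz by (simp add: contour_integral_join contour_integrable_joinI int1)
  finally have eq: "Q b - Q a - 2 * pi * \<i> * \<phi> 0
      = - contour_integral (linepath b d) (\<lambda>w. \<phi> w / w)
        - contour_integral (linepath d a) (\<lambda>w. \<phi> w / w)"
    by simp
  have len: "norm (d - b) \<le> 2 * r" "norm (a - d) \<le> 2 * r"
    using norm_segment_length_le[of 1 "-1" r c] norm_segment_length_le[of "-1" "-1" r c] c
    by (auto simp: a_b_d_def norm_minus_commute)
  have "norm (contour_integral (linepath b d) (\<lambda>w. \<phi> w / w)) \<le> B * norm (d - b)"
    by (rule contour_integral_bound_linepath) (use ci nz B seg h in auto)
  moreover have "norm (contour_integral (linepath d a) (\<lambda>w. \<phi> w / w)) \<le> B * norm (a - d)"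
    by (rule contour_integral_bound_linepath) (use ci nz B seg h in auto)
  moreover have "B * norm (d - b) \<le> B * (2 * r)" "B * norm (a - d) \<le> B * (2 * r)"
    using B len by (auto intro: mult_left_mono)
  ultimately have "norm (Q b - Q a - 2 * pi * \<i> * \<phi> 0) \<le> B * (4 * r)"
    unfolding eq
    using norm_triangle_ineq4[of "- contour_integral (linepath b d) (\<lambda>w. \<phi> w / w)"
        "contour_integral (linepath d a) (\<lambda>w. \<phi> w / w)"] by simp
  then show ?thesis
    by (simp add: a_b_d_def)
qed

text \<open>The decay of order -1 - k is integrable along the whole line. This gives a bound
  independent of \<open>r\<close> and is the source of the factor 1/k.\<close>

lemma primitive_bound_vertical:
  assumes F: "\<And>s. 0 < Re s \<Longrightarrow> (F has_field_derivative h s) (at s)"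
    and c: "0 < c" "0 < r" and k: "0 < k" "k \<le> 1" and K: "0 \<le> K"
    and h: "\<And>s. Re s = c \<Longrightarrow> norm (h s) \<le> K * norm s powr (- 1 - k)"
  shows "norm (F (Complex c r) - F (Complex c (- r))) \<le> 8 * K * c powr (- k) / k"
proof -
  have *: "norm (F (Complex c (\<sigma> * r)) - F (Complex c 0)) \<le> 4 * K * c powr (- k) / k"
    if \<sigma>: "\<sigma> \<in> {1, -1}" for \<sigma>
  proof -
    \<comment> \<open>An antiderivative of the majorant
      \<open>4 * K * (c + y) powr (- 1 - k)\<close>. It is nowhere positive, so its increment from 0
      is at most \<open>- \<phi> 0\<close> for every \<open>r\<close>.\<close>
    define \<phi> where "\<phi> y = - (4 * K / k) * (c + y) powr (- k)" for y :: real
    let ?z = "\<lambda>y. Complex c (\<sigma> * y)"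
    have z: "(?z has_vector_derivative (\<sigma> * \<i>)) (at y)" for y
    proof -
      have "((\<lambda>y. of_real c + complex_of_real y * (\<sigma> * \<i>)) has_vector_derivative (\<sigma> * \<i>)) (at y)"
        by (rule has_vector_derivative_real_field) (auto intro!: derivative_eq_intros)
      then show ?thesis
        by (simp add: Complex_eq algebra_simps)
    qed
    have d1: "((\<lambda>y. F (?z y)) has_vector_derivative (\<sigma> * \<i> * h (?z y))) (at y)" for y
      using field_vector_diff_chain_at[OF z F, of y] c by (simp add: o_def)
    have d2: "(\<phi> has_vector_derivative (4 * K * (c + y) powr (- 1 - k))) (at y)" if "0 \<le> y" for y
      unfolding \<phi>_def has_real_derivative_iff_has_vector_derivative[symmetric]
      using c k that
      by (auto intro!: derivative_eq_intros simp: field_simps minus_diff_commute)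
    have bnd: "norm (\<sigma> * \<i> * h (?z y)) \<le> 4 * K * (c + y) powr (- 1 - k)" if y: "0 \<le> y" for y
    proof -
      \<comment> \<open>The norm dominates both \<open>c\<close> and \<open>y\<close>, hence their
        mean. The halving costs \<open>2 powr (1 + k)\<close>, which is at most 4.\<close>
      have "(c + y) / 2 \<le> norm (?z y)"
        using abs_Re_le_cmod[of "?z y"] abs_Im_le_cmod[of "?z y"] \<sigma> y c by (auto simp: abs_mult)
      then have "norm (?z y) powr (- 1 - k) \<le> ((c + y) / 2) powr (- 1 - k)"
        by (intro powr_mono2') (use c y k in auto)
      also have "\<dots> = 2 powr (1 + k) * (c + y) powr (- 1 - k)"
        using c y powr_minus[of 2 "1 + k"] by (simp add: powr_divide field_simps)
      also have "\<dots> \<le> 2 powr 2 * (c + y) powr (- 1 - k)"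
        by (intro mult_right_mono powr_mono) (use k in auto)
      finally have "K * norm (?z y) powr (- 1 - k) \<le> K * (4 * (c + y) powr (- 1 - k))"
        using K by (intro mult_left_mono) auto
      then show ?thesis
        using h[of "?z y"] \<sigma> by (auto simp: norm_mult)
    qed
    have "norm (F (?z r) - F (?z 0)) \<le> \<phi> r - \<phi> 0"
    proof (rule differentiable_bound_general[where f' = "\<lambda>y. \<sigma> * \<i> * h (?z y)"
            and \<phi>' = "\<lambda>y. 4 * K * (c + y) powr (- 1 - k)"])
      show "continuous_on {0..r} (\<lambda>y. F (?z y))"
        by (intro continuous_at_imp_continuous_on ballI)
           (use d1 has_vector_derivative_continuous in blast)
      show "continuous_on {0..r} \<phi>"
        by (intro continuous_at_imp_continuous_on ballI)
           (use has_vector_derivative_continuous[OF d2] in auto)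
    qed (use c d1 d2 bnd in auto)
    also have "\<dots> \<le> 4 * K * c powr (- k) / k"
      using K k by (simp add: \<phi>_def)
    finally show ?thesis by simp
  qed
  show ?thesis
    using *[of 1] *[of "-1"]
      norm_triangle_ineq4[of "F (Complex c r) - F (Complex c 0)" "F (Complex c (- r)) - F (Complex c 0)"]
    by simp
qed

section \<open>The kernel estimate at the origin\<close>

text \<open>\<open>A\<close> and \<open>G\<close> enter only on the slanted sides, whose
  contribution vanishes in the limit, so \<open>M\<close> alone survives. The growth rates match the
  kernel: \<open>exp (- m * Re s)\<close> cancels its exponential on the right,
  \<open>exp (- l * Re s)\<close> on the left.\<close>

lemma vp_kernel_bound:
  assumes f: "f holomorphic_on right_halfplane 0" "\<And>s. 0 < Re s \<Longrightarrow> norm (f s) \<le> M"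
    and S: "S holomorphic_on UNIV" "\<And>s. Re s \<le> 1 / m \<Longrightarrow> norm (S s) \<le> A * exp (- l * Re s)"
    and G: "\<And>s. 0 < Re s \<Longrightarrow> norm (f s - S s) \<le> G * (1 + norm s) * exp (- m * Re s)"
    and lm: "0 \<le> l" "l < m" and k: "0 < k" "k \<le> 1"
  shows "2 * pi * norm (S 0) \<le> 32 * exp 1 * M * (m / (m - l)) powr k / k"
proof -
  define e where "e = (m - l) / 2"
  \<comment> \<open>On this line the kernel's factor \<open>exp (m * Re s)\<close> is just
    \<open>exp 1\<close>.\<close>
  define c where "c = 1 / m"
  let ?E = "vp_kernel l e"
  have e: "0 < e" "l + 2 * e = m" and c: "0 < c" "m * c = 1"
    using lm by (auto simp: e_def c_def field_simps)
  have M: "0 \<le> M"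
    using f(2)[of 1] norm_ge_zero[of "f 1"] by (simp del: norm_ge_zero)
  have G0: "0 \<le> G"
  proof -
    have "0 \<le> G * (2 * exp (- m))"
      using G[of 1] norm_ge_zero[of "f 1 - S 1"] by (simp del: norm_ge_zero)
    then show ?thesis
      by (simp add: zero_le_mult_iff)
  qed
  have H: "open {s. 0 < Re s}" "convex {s. 0 < Re s}"
    by (auto intro: open_halfspace_Re_gt convex_halfspace_Re_gt)
  have fh: "f holomorphic_on {s. 0 < Re s}"
    using f(1) by (simp add: right_halfplane_def)
  have Sh: "S holomorphic_on {s. 0 < Re s}"
    using S(1) holomorphic_on_subset by blast
  have Eh: "?E holomorphic_on {s. 0 < Re s}"
    unfolding vp_kernel_def
    by (intro holomorphic_intros holomorphic_exp_quot) (use e in auto)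
  have "(\<lambda>s. f s * ?E s) holomorphic_on {s. 0 < Re s}"
    "(\<lambda>s. (f s - S s) * ?E s) holomorphic_on {s. 0 < Re s}"
    by (intro holomorphic_intros fh Sh Eh)+
  then obtain F P where
    F: "\<And>s. 0 < Re s \<Longrightarrow> (F has_field_derivative f s * ?E s) (at s)" and
    P: "\<And>s. 0 < Re s \<Longrightarrow> (P has_field_derivative (f s - S s) * ?E s) (at s)"
    using holomorphic_convex_primitive'[OF H(2,1)] at_within_open[OF _ H(1)]
    by (metis (no_types, lifting) mem_Collect_eq)
  define \<phi> where "\<phi> s = S s * (exp (of_real l * s) * exp_quot e s ^ 2)" for s
  have \<phi>: "\<phi> holomorphic_on UNIV" "\<phi> 0 = S 0"
    unfolding \<phi>_def using e
    by (intro holomorphic_intros holomorphic_exp_quot S(1)) (auto simp: exp_quot_def)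
  have \<phi>E: "\<phi> s / s = S s * ?E s" for s
    by (simp add: \<phi>_def vp_kernel_def)
  \<comment> \<open>Taking \<open>F - P\<close> as the primitive of \<open>S\<close> times the
    kernel makes the increments of the three primitives cancel exactly in
    \<open>main\<close>.\<close>
  have Q: "((\<lambda>s. F s - P s) has_field_derivative \<phi> s / s) (at s)" if "0 < Re s" for s
    using DERIV_diff[OF F P, OF that that] by (simp add: \<phi>E algebra_simps)

  define K where "K = M * exp 1 * (2 / e) powr k"
  have K: "norm (f s * ?E s) \<le> K * norm s powr (- 1 - k)" if "Re s = c" for s
  proof -
    have s: "s \<noteq> 0" "0 < norm s"
      using that c by auto
    have "norm (?E s) \<le> exp (m * c) * (2 / (e * norm s)) powr k / norm s"
      using norm_vp_kernel_le_right[of e s k l] that s c e k by simp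
    also have "\<dots> = exp 1 * (2 / e) powr k * norm s powr (- 1 - k)"
      using s e c by (simp add: powr_divide powr_mult powr_diff powr_minus field_simps)
    finally have "norm (f s) * norm (?E s) \<le> M * (exp 1 * (2 / e) powr k * norm s powr (- 1 - k))"
      using f(2)[of s] that c M by (intro mult_mono) auto
    then show ?thesis
      by (simp add: norm_mult K_def mult.assoc)
  qed
  define B where "B = 8 * K * c powr (- k) / k"
  have FB: "norm (F (Complex c r) - F (Complex c (- r))) \<le> B" if "0 < r" for r
    unfolding B_def by (rule primitive_bound_vertical[OF F]) (use that K c k M in \<open>auto simp: K_def\<close>)

  \<comment> \<open>In \<open>X\<close>, 4 comes from the squared kernel bound, 2 from
    \<open>1 + norm s \<le> 2 * norm s\<close>, and 16 from \<open>r / 4 \<le> norm s\<close>; the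
    last also gives the 16 in \<open>Y\<close>. The condition \<open>4 \<le> r\<close> below ensures
    \<open>1 \<le> norm s\<close>.\<close>
  define X where "X = 128 * G / e\<^sup>2"
  define Y where "Y = 16 * A * ((1 + exp (e * c)) / e)\<^sup>2"
  have R: "norm ((f s - S s) * ?E s) \<le> X / r\<^sup>2"
    if s: "c \<le> Re s" "r / 4 \<le> norm s" and r: "4 \<le> r" for s r
  proof -
    have n1: "1 \<le> norm s" and nz: "s \<noteq> 0"
      using s r c by auto
    have "norm (?E s) \<le> exp (m * Re s) * (2 / (e * norm s)) powr 2 / norm s"
      using norm_vp_kernel_le_right[of e s 2 l] s c nz e by simp
    then have "norm ((f s - S s) * ?E s) \<le>
        (G * (1 + norm s) * exp (- m * Re s)) * (exp (m * Re s) * (2 / (e * norm s)) powr 2 / norm s)"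
      unfolding norm_mult using G[of s] s c G0 by (intro mult_mono) auto
    also have "\<dots> = G * (1 + norm s) * (2 / (e * norm s))\<^sup>2 / norm s"
      using e nz by (simp add: exp_minus field_simps powr_numeral)
    also have "\<dots> \<le> G * (2 * norm s) * (2 / (e * norm s))\<^sup>2 / norm s"
      using n1 G0 by (intro divide_right_mono mult_right_mono mult_left_mono) auto
    also have "\<dots> = 8 * G / e\<^sup>2 / (norm s)\<^sup>2"
      using nz by (simp add: field_simps power2_eq_square)
    also have "\<dots> \<le> 8 * G / e\<^sup>2 / (r / 4)\<^sup>2"
      using s r G0 by (intro divide_left_mono power_mono mult_pos_pos zero_less_power) auto
    also have "\<dots> = X / r\<^sup>2"
      by (simp add: X_def field_simps)
    finally show ?thesis .
  qed
  have L: "norm (\<phi> s / s) \<le> Y / r\<^sup>2"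
    if s: "Re s \<le> c" "r / 4 \<le> norm s" and r: "4 \<le> r" for s r
  proof -
    have n1: "1 \<le> norm s" and nz: "s \<noteq> 0"
      using s r by auto
    have S': "norm (S s) \<le> A * exp (- l * Re s)"
      using S(2) s by (simp add: c_def)
    then have A: "0 \<le> A"
      using norm_ge_zero[of "S s"] by (smt (verit) exp_gt_zero zero_le_mult_iff)
    have "norm (exp_quot e s) ^ 2 \<le> ((1 + exp (e * c)) / (e * norm s)) ^ 2"
      by (intro power_mono norm_exp_quot_le_left) (use e s nz in auto)
    then have "norm (\<phi> s / s) \<le> (A * exp (- l * Re s)) *
        (exp (l * Re s) * ((1 + exp (e * c)) / (e * norm s))\<^sup>2) / norm s"
      unfolding \<phi>_def norm_mult norm_divide norm_power
      using S' A by (intro divide_right_mono mult_mono) auto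
    also have "\<dots> = A * ((1 + exp (e * c)) / e)\<^sup>2 / (norm s)\<^sup>2 / norm s"
      by (simp add: exp_minus field_simps)
    also have "\<dots> \<le> A * ((1 + exp (e * c)) / e)\<^sup>2 / (norm s)\<^sup>2 / 1"
      using n1 A by (intro divide_left_mono) auto
    also have "\<dots> \<le> A * ((1 + exp (e * c)) / e)\<^sup>2 / (r / 4)\<^sup>2 / 1"
      using s r A by (intro divide_right_mono divide_left_mono power_mono mult_pos_pos zero_less_power) auto
    also have "\<dots> = Y / r\<^sup>2"
      by (simp add: Y_def field_simps)
    finally show ?thesis .
  qed

  \<comment> \<open>The slanted sides on either side of the line have total length at most 4r
    against integrands of order \<open>1 / r\<^sup>2\<close>, so the error is of order 1/r.\<close>
  have main: "2 * pi * norm (S 0) \<le> B + 4 * (X + Y) / r" if r: "max 4 (4 * c) \<le> r" for r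
  proof -
    let ?D = "\<lambda>T. T (Complex c r) - T (Complex c (- r))"
    have r': "4 \<le> r" "4 * c \<le> r" "0 < r"
      using r by auto
    have p: "norm (?D P) \<le> X / r\<^sup>2 * (4 * r)"
      by (rule primitive_bound_right[OF P]) (use r' c R in auto)
    have q: "norm (?D (\<lambda>s. F s - P s) - 2 * pi * \<i> * \<phi> 0) \<le> Y / r\<^sup>2 * (4 * r)"
      by (rule primitive_residue_left[OF Q \<phi>(1)]) (use r' c L in auto)
    have "2 * pi * norm (S 0) = norm (2 * pi * \<i> * \<phi> 0)"
      by (simp add: \<phi> norm_mult)
    also have "2 * pi * \<i> * \<phi> 0 = ?D F - ?D P - (?D (\<lambda>s. F s - P s) - 2 * pi * \<i> * \<phi> 0)"
      by simp
    also have "norm \<dots> \<le> norm (?D F) + norm (?D P) + norm (?D (\<lambda>s. F s - P s) - 2 * pi * \<i> * \<phi> 0)"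
      by (rule order_trans[OF norm_triangle_ineq4 add_right_mono]) (rule norm_triangle_ineq4)
    also have "\<dots> \<le> B + X / r\<^sup>2 * (4 * r) + Y / r\<^sup>2 * (4 * r)"
      using FB[OF r'(3)] p q by linarith
    also have "\<dots> = B + 4 * (X + Y) / r"
      using r' by (simp add: field_simps power2_eq_square)
    finally show ?thesis .
  qed
  have "((\<lambda>r. B + 4 * (X + Y) / r) \<longlongrightarrow> B + 0) at_top"
    by (intro tendsto_intros tendsto_divide_0[OF tendsto_const] filterlim_at_top_imp_at_infinity
          filterlim_ident)
  moreover have "\<forall>\<^sub>F r in at_top. 2 * pi * norm (S 0) \<le> B + 4 * (X + Y) / r"
    using main unfolding eventually_at_top_linorder by blast
  ultimately have "2 * pi * norm (S 0) \<le> B + 0"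
    by (rule tendsto_lowerbound) simp
  then have "2 * pi * norm (S 0) \<le> B"
    by simp
  also have "B = 8 * exp 1 * M * ((2 / e) powr k * c powr (- k)) / k"
    by (simp add: B_def K_def)
  \<comment> \<open>Here 2/e is 4/(m - l) and 1/c is m. Bounding \<open>4 powr k\<close> by 4 then
    turns the constant 8 into 32.\<close>
  also have "(2 / e) powr k * c powr (- k) = 4 powr k * (m / (m - l)) powr k"
    using lm by (simp add: e_def c_def powr_minus powr_divide powr_mult field_simps)
  also have "8 * exp 1 * M * (4 powr k * (m / (m - l)) powr k) / k
      \<le> 8 * exp 1 * M * (4 powr 1 * (m / (m - l)) powr k) / k"
    using M k by (intro divide_right_mono mult_left_mono mult_right_mono powr_mono) auto
  finally show ?thesis by simp
qed

section \<open>Decay of the extension minus a partial sum\<close>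

text \<open>Abel summation: passing from \<open>z\<close> to \<open>z + w\<close> multiplies the
  n-th term by \<open>exp (- l n * w)\<close>, and bounded partial sums at \<open>z\<close> are
  weighted by the differences of these factors.\<close>

lemma dirichlet_partial_sum_tail_bound:
  assumes l: "frequency l" and N: "N + 1 \<le> m" and w: "Re w > 0"
    and B: "\<And>n. norm (dirichlet_partial_sum l a n z - dirichlet_partial_sum l a N z) \<le> B"
  shows "norm (dirichlet_partial_sum l a m (z + w) - dirichlet_partial_sum l a N (z + w))
           \<le> B * (1 + norm w / Re w) * exp (- l (N + 1) * Re w)"
proof -
  define T where "T n s = dirichlet_partial_sum l a n s - dirichlet_partial_sum l a N s" for n s
  define E where "E n = exp (- complex_of_real (l n) * w)" for n
  have le: "l i \<le> l j" if "1 \<le> i" "i \<le> j" for i j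
    using l that by (cases "i = j") (auto simp: frequency_def strict_mono_on_def order_le_less)
  have T_Suc: "T (Suc n) (z + w) = T n (z + w) + (T (Suc n) z - T n z) * E (Suc n)" for n
  proof -
    have "exp (- (complex_of_real (l (Suc n)) * (z + w)))
        = exp (- (complex_of_real (l (Suc n)) * z)) * exp (- (complex_of_real (l (Suc n)) * w))"
      by (simp add: ring_distribs flip: exp_add)
    then show ?thesis
      by (simp add: T_def E_def dirichlet_partial_sum_def)
  qed
  have B0: "0 \<le> B"
    using B[of N] by simp
  \<comment> \<open>\<open>T m z * E m\<close> is the boundary term. Since \<open>T N\<close>
    vanishes, both sides are 0 at \<open>m = N + 1\<close>, and the telescoping bound starts at the
    exponent \<open>l (N + 1)\<close>, which gives the decay rate.\<close>
  have "norm (T m (z + w) - T m z * E m)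
      \<le> B * (norm w / Re w * (exp (- l (N + 1) * Re w) - exp (- l m * Re w)))"
    using N
  proof (induction m rule: dec_induct)
    case base
    show ?case
      using T_Suc[of N] by (simp add: T_def)
  next
    case (step n)
    have E: "norm (E n - E (Suc n))
        \<le> norm w / Re w * (exp (- l n * Re w) - exp (- l (Suc n) * Re w))"
      unfolding E_def by (rule norm_exp_diff_le) (use w le step.hyps in auto)
    have "T (Suc n) (z + w) - T (Suc n) z * E (Suc n)
        = (T n (z + w) - T n z * E n) + T n z * (E n - E (Suc n))"
      unfolding T_Suc[of n] by (simp add: algebra_simps)
    also have "norm \<dots> \<le> norm (T n (z + w) - T n z * E n) + norm (T n z) * norm (E n - E (Suc n))"
      by (metis norm_mult norm_triangle_ineq)
    also have "\<dots> \<le> B * (norm w / Re w * (exp (- l (N + 1) * Re w) - exp (- l n * Re w)))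
        + B * (norm w / Re w * (exp (- l n * Re w) - exp (- l (Suc n) * Re w)))"
      by (intro add_mono step.IH mult_mono E B0) (use B in \<open>auto simp: T_def\<close>)
    also have "\<dots> = B * (norm w / Re w * (exp (- l (N + 1) * Re w) - exp (- l (Suc n) * Re w)))"
      by (simp add: algebra_simps)
    finally show ?case .
  qed
  also have "\<dots> \<le> B * (norm w / Re w * exp (- l (N + 1) * Re w))"
    using w B0 by (intro mult_left_mono) auto
  finally have 1: "norm (T m (z + w) - T m z * E m) \<le> \<dots>" .
  have "norm (T m z * E m) \<le> B * exp (- l (N + 1) * Re w)"
    unfolding norm_mult E_def
    by (intro mult_mono B0) (use B w le[OF _ N] in \<open>auto simp: T_def\<close>)
  then show ?thesis
    using 1 norm_triangle_ineq[of "T m (z + w) - T m z * E m" "T m z * E m"]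
    by (simp add: algebra_simps T_def[symmetric])
qed

text \<open>For \<open>Re s > \<sigma> + 2\<close> the series converges to \<open>f\<close>, and the
  tail bound based at \<open>\<sigma> + 1\<close> passes to the limit. In the remaining strip the
  exponential is bounded below, so boundedness of \<open>f\<close> and of the partial sum
  suffices.\<close>

lemma bounded_extension_minus_partial_sum_bound:
  assumes l: "frequency l" and f: "bounded_extension l a f"
  obtains G where "\<And>s. 0 < Re s \<Longrightarrow>
    norm (f s - dirichlet_partial_sum l a N s) \<le> G * (1 + norm s) * exp (- l (N + 1) * Re s)"
proof -
  let ?P = "dirichlet_partial_sum l a" and ?m = "l (N + 1)"
  obtain \<sigma> where \<sigma>: "0 \<le> \<sigma>" "\<And>s. \<sigma> < Re s \<Longrightarrow> (\<lambda>n. ?P n s) \<longlonglongrightarrow> f s"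
    using f by (auto simp: bounded_extension_def dirichlet_converges_to_def right_halfplane_def)
  define z where "z = complex_of_real (\<sigma> + 1)"
  have m: "0 \<le> ?m"
    using l by (simp add: frequency_def)
  have "convergent (\<lambda>n. ?P n z - ?P N z)"
    using \<sigma>(2)[of z] by (intro convergent_diff convergent_const) (auto simp: z_def convergent_def)
  then obtain B where B: "\<And>n. norm (?P n z - ?P N z) \<le> B" and B0: "0 < B"
    by (metis BseqE convergent_imp_Bseq)
  obtain M where M: "\<And>s. 0 < Re s \<Longrightarrow> norm (f s) \<le> M"
    using f by (auto simp: bounded_extension_def right_halfplane_def bounded_iff)
  obtain A where A: "\<And>s. 0 < Re s \<Longrightarrow> norm (?P N s) \<le> A"
    using bdd_above_dirichlet_partial_sum[OF l, of a N]
    by (auto simp: bdd_above_def right_halfplane_def)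
  have M0: "0 \<le> M" and A0: "0 \<le> A"
    using M[of 1] A[of 1] norm_ge_zero order_trans by (auto simp del: norm_ge_zero)
  \<comment> \<open>The maximum serves the two ranges of \<open>Re s\<close>. The exponential factor
    pays for the strip and for measuring decay from \<open>z\<close> instead of 0.\<close>
  define G where "G = max (M + A) (B * (\<sigma> + 2)) * exp (?m * (\<sigma> + 2))"
  have G0: "0 \<le> G"
    using M0 A0 by (simp add: G_def le_max_iff_disj)
  show thesis
  proof (rule that)
    fix s :: complex assume s: "0 < Re s"
    show "norm (f s - ?P N s) \<le> G * (1 + norm s) * exp (- ?m * Re s)"
    proof (cases "Re s \<le> \<sigma> + 2")
      case True
      have "norm (f s - ?P N s) \<le> M + A"
        using M[OF s] A[OF s] norm_triangle_ineq4[of "f s" "?P N s"] by linarith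
      also have "\<dots> = (M + A) * exp (?m * Re s) * 1 * exp (- ?m * Re s)"
        by (simp add: exp_minus)
      also have "\<dots> \<le> G * (1 + norm s) * exp (- ?m * Re s)"
        unfolding G_def
        by (intro mult_right_mono mult_mono) (use True m M0 A0 in \<open>auto intro: mult_left_mono\<close>)
      finally show ?thesis .
    next
      case False
      define w where "w = s - z"
      have w: "1 < Re w" "s = z + w" "Re w = Re s - (\<sigma> + 1)"
        using False by (auto simp: w_def z_def)
      have "norm w \<le> norm s + norm z"
        unfolding w_def by (rule norm_triangle_ineq4)
      also have "norm z = \<sigma> + 1"
        using \<sigma>(1) unfolding z_def norm_of_real by simp
      \<comment> \<open>As \<open>Re w > 1\<close>, the quotient is at most \<open>norm w\<close>,
        hence at most \<open>norm s + \<sigma> + 1\<close>.\<close>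
      finally have nw: "1 + norm w / Re w \<le> (\<sigma> + 2) * (1 + norm s)"
        using divide_left_mono[of 1 "Re w" "norm w", OF _ norm_ge_zero] w(1)
          mult_nonneg_nonneg[OF \<sigma>(1) norm_ge_zero[of s]] norm_ge_zero[of s]
        by (simp add: algebra_simps del: norm_ge_zero)
      have "(\<lambda>n. norm (?P n s - ?P N s)) \<longlonglongrightarrow> norm (f s - ?P N s)"
        using \<sigma>(2)[of s] False by (intro tendsto_intros) auto
      then have "norm (f s - ?P N s) \<le> B * (1 + norm w / Re w) * exp (- ?m * Re w)"
      proof (rule tendsto_upperbound)
        have "norm (?P n s - ?P N s) \<le> B * (1 + norm w / Re w) * exp (- ?m * Re w)"
          if "N + 1 \<le> n" for n
          unfolding w(2)
          by (rule dirichlet_partial_sum_tail_bound[OF l that _ B]) (use w(1) in simp)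
        then show "\<forall>\<^sub>F n in sequentially.
            norm (?P n s - ?P N s) \<le> B * (1 + norm w / Re w) * exp (- ?m * Re w)"
          by (rule eventually_sequentiallyI)
      qed simp
      also have "\<dots> \<le> B * ((\<sigma> + 2) * (1 + norm s)) * (exp (?m * (\<sigma> + 2)) * exp (- ?m * Re s))"
      proof (intro mult_mono mult_left_mono nw)
        show "exp (- ?m * Re w) \<le> exp (?m * (\<sigma> + 2)) * exp (- ?m * Re s)"
          using m by (simp add: w(3) algebra_simps flip: exp_add)
      qed (use w(1) B0 \<sigma>(1) in auto)
      also have "\<dots> = (B * (\<sigma> + 2)) * exp (?m * (\<sigma> + 2)) * (1 + norm s) * exp (- ?m * Re s)"
        by (simp add: mult_ac)
      also have "\<dots> \<le> G * (1 + norm s) * exp (- ?m * Re s)"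
        unfolding G_def by (intro mult_right_mono) auto
      finally show ?thesis .
    qed
  qed
qed

section \<open>Translation to the half-plane and the uniform constant\<close>

text \<open>The kernel estimate is applied to the translates of \<open>f\<close> and of the partial
  sum by \<open>s\<close> and read off at 0; translation to the right preserves the bound
  \<open>M\<close>.\<close>

lemma norm_dirichlet_partial_sum_le:
  assumes l: "frequency l" and N: "1 \<le> N" and f: "bounded_extension l a f"
    and M: "\<And>s. 0 < Re s \<Longrightarrow> norm (f s) \<le> M"
    and k: "0 < k" "k \<le> 1" and s: "0 < Re s"
  shows "norm (dirichlet_partial_sum l a N s)
    \<le> 32 * exp 1 * M * (l (N + 1) / (l (N + 1) - l N)) powr k / k"
proof -
  let ?P = "dirichlet_partial_sum l a N" and ?m = "l (N + 1)"
  have lN: "0 \<le> l N" "l N < ?m" and le: "\<And>n. 1 \<le> n \<Longrightarrow> n \<le> N \<Longrightarrow> l n \<le> l N"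
    using l N by (auto simp: frequency_def strict_mono_on_def order_le_less)
  obtain G where G: "\<And>z. 0 < Re z \<Longrightarrow>
      norm (f z - ?P z) \<le> G * (1 + norm z) * exp (- ?m * Re z)"
    using bounded_extension_minus_partial_sum_bound[OF l f] by blast
  have G0: "0 \<le> G"
  proof -
    have "0 \<le> G * (2 * exp (- ?m))"
      using order_trans[OF norm_ge_zero G[of 1]] by simp
    then show ?thesis
      by (simp add: zero_le_mult_iff)
  qed
  \<comment> \<open>Replacing the rate \<open>l n\<close> by the largest rate \<open>l N\<close>
    costs \<open>exp ((l N - l n) * Re z)\<close>, which is controlled because
    \<open>Re z \<le> 1 / ?m\<close>.\<close>
  define A where "A = (\<Sum>n=1..N. norm (a n) * exp (- l n * Re s) * exp ((l N - l n) / ?m))"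
  have "2 * pi * norm (?P (0 + s)) \<le> 32 * exp 1 * M * (?m / (?m - l N)) powr k / k"
  proof (rule vp_kernel_bound[where S = "\<lambda>z. ?P (z + s)" and f = "\<lambda>z. f (z + s)"])
    show "(\<lambda>z. f (z + s)) holomorphic_on right_halfplane 0"
      using holomorphic_on_compose_gen[of "\<lambda>z. z + s" "right_halfplane 0" f "right_halfplane 0"] f s
      by (force simp: bounded_extension_def right_halfplane_def o_def intro!: holomorphic_intros)
    show "(\<lambda>z. ?P (z + s)) holomorphic_on UNIV"
      unfolding dirichlet_partial_sum_def by (intro holomorphic_intros)
    fix z :: complex
    show "norm (f (z + s)) \<le> M" if "0 < Re z"
      using M that s by simp
    show "norm (?P (z + s)) \<le> A * exp (- l N * Re z)" if z: "Re z \<le> 1 / ?m"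
      unfolding dirichlet_partial_sum_def A_def sum_distrib_right
    proof (intro sum_norm_le)
      fix n assume n: "n \<in> {1..N}"
      have "(l N - l n) * Re z \<le> (l N - l n) * (1 / ?m)"
        using z le n by (intro mult_left_mono) auto
      then have *: "- l n * (Re z + Re s) \<le> - l n * Re s + (l N - l n) / ?m + - l N * Re z"
        by (simp add: algebra_simps)
      have "norm (a n * exp (- complex_of_real (l n) * (z + s))) = norm (a n) * exp (- l n * (Re z + Re s))"
        by (simp add: norm_mult)
      also have "\<dots> \<le> norm (a n) * exp (- l n * Re s + (l N - l n) / ?m + - l N * Re z)"
        using * by (intro mult_left_mono) auto
      also have "\<dots> = norm (a n) * exp (- l n * Re s) * exp ((l N - l n) / ?m) * exp (- l N * Re z)"
        by (simp only: exp_add mult.assoc)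
      finally show "norm (a n * exp (- complex_of_real (l n) * (z + s)))
          \<le> norm (a n) * exp (- l n * Re s) * exp ((l N - l n) / ?m) * exp (- l N * Re z)" .
    qed
    show "norm (f (z + s) - ?P (z + s)) \<le> G * (1 + norm s) * (1 + norm z) * exp (- ?m * Re z)"
      if z: "0 < Re z"
    proof -
      have "norm (f (z + s) - ?P (z + s)) \<le> G * (1 + norm (z + s)) * exp (- ?m * Re (z + s))"
        using z s by (intro G) auto
      also have "\<dots> \<le> G * ((1 + norm s) * (1 + norm z)) * exp (- ?m * Re z)"
      proof (intro mult_mono mult_left_mono)
        show "1 + norm (z + s) \<le> (1 + norm s) * (1 + norm z)"
          using norm_triangle_ineq[of z s] mult_nonneg_nonneg[OF norm_ge_zero[of s] norm_ge_zero[of z]]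
          unfolding ring_distribs by linarith
      qed (use G0 s lN in auto)
      finally show ?thesis by (simp add: mult.assoc)
    qed
  qed (use lN k in auto)
  moreover have "1 * norm (?P s) \<le> 2 * pi * norm (?P s)"
    using pi_gt3 by (intro mult_right_mono) auto
  ultimately show ?thesis by simp
qed

theorem theorem3p2:
  shows "\<exists>C>0. \<forall>(l :: nat \<Rightarrow> real) (k :: real) (N :: nat) (a :: nat \<Rightarrow> complex).
    frequency l \<longrightarrow> 0 < k \<longrightarrow> k \<le> 1 \<longrightarrow> 1 \<le> N \<longrightarrow> a \<in> D_infty_ext l \<longrightarrow>
      (SUP s\<in>right_halfplane 0. norm (dirichlet_partial_sum l a N s))
        \<le> C * (Gamma (k + 1) / k) * (l (N + 1) / (l (N + 1) - l N)) powr k * D_infty_norm l a"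
proof -
  have "continuous_on {1..2} (Gamma :: real \<Rightarrow> real)"
    by (rule continuous_on_Gamma) (auto elim!: nonpos_Ints_cases)
  \<comment> \<open>The minimum of Gamma on a compact interval containing all \<open>k + 1\<close>;
    it is positive and independent of \<open>k\<close>.\<close>
  then obtain x :: real where x: "x \<in> {1..2}" "\<And>y. y \<in> {1..2} \<Longrightarrow> Gamma x \<le> Gamma y"
    using continuous_attains_inf[of "{1..2::real}" Gamma] by auto
  have \<gamma>: "0 < Gamma x"
    using x(1) by (intro Gamma_real_pos) auto
  show ?thesis
  proof (rule exI[of _ "32 * exp 1 / Gamma x"], intro conjI allI impI)
    show "0 < 32 * exp 1 / Gamma x"
      using \<gamma> by simp
    fix l :: "nat \<Rightarrow> real" and k :: real and N :: nat and a :: "nat \<Rightarrow> complex"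
    assume l: "frequency l" and k: "0 < k" "k \<le> 1" and N: "1 \<le> N" and a: "a \<in> D_infty_ext l"
    obtain f where f: "bounded_extension l a f"
      using a by (auto simp: D_infty_ext_def)
    let ?M = "D_infty_norm l a" and ?R = "(l (N + 1) / (l (N + 1) - l N)) powr k"
    have M: "norm (f s) \<le> ?M" if "0 < Re s" for s
      unfolding D_infty_norm_eq[OF f]
      by (rule cSUP_upper) (use that bdd_above_bounded_extension[OF f] in \<open>auto simp: right_halfplane_def\<close>)
    have M0: "0 \<le> ?M"
      using order_trans[OF norm_ge_zero M[of 1]] by simp
    \<comment> \<open>This ratio inserts the Gamma factor into a bound that was proved without
      it.\<close>
    have "1 \<le> Gamma (k + 1) / Gamma x"
      using x(2)[of "k + 1"] k \<gamma> by simp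
    then have "1 * (32 * exp 1 * ?M * ?R / k)
        \<le> Gamma (k + 1) / Gamma x * (32 * exp 1 * ?M * ?R / k)"
      using M0 k by (intro mult_right_mono) auto
    also have "\<dots> = 32 * exp 1 / Gamma x * (Gamma (k + 1) / k) * ?R * ?M"
      by simp
    finally have le: "32 * exp 1 * ?M * ?R / k \<le> \<dots>" by simp
    show "(SUP s\<in>right_halfplane 0. norm (dirichlet_partial_sum l a N s))
        \<le> 32 * exp 1 / Gamma x * (Gamma (k + 1) / k) * ?R * ?M"
    proof (rule cSUP_least[OF right_halfplane_nonempty])
      fix s assume "s \<in> right_halfplane 0"
      then show "norm (dirichlet_partial_sum l a N s)
          \<le> 32 * exp 1 / Gamma x * (Gamma (k + 1) / k) * ?R * ?M"
        using norm_dirichlet_partial_sum_le[OF l N f M k, of s] le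
        by (simp add: right_halfplane_def)
    qed
  qed
qed

end
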